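(* Let $B$ be a $\theta$-type bicyclic graph. If $B$ possesses a unique perfect matching, then $B$ is unimodular.
   Context: All graphs are finite, undirected and simple. A connected graph $B$ is bicyclic if $|E(B)|=|V(B)|+1$. A bicyclic graph is called $\theta$-type if its cycles are not (pairwise) edge-disjoint; it then has exactly three cycles. $A(B)$ denotes the $0$-$1$ adjacency matrix of $B$; $B$ is unimodular if $\det A(B)\in\{-1,1\}$. A perfect matching is a spanning subgraph each of whose components is a $K_2$. *)

theory Defs
  imports
    "Graph_Theory.Graph_Theory"
    "Jordan_Normal_Form.Determinant"
    "HOL-Library.Disjoint_Sets"
begin

text \<open>
  A finite undirected simple graph is a \<^const>\<open>pair_graph\<close>: a finite symmetric loopless
  set of pairs on a finite vertex set. Every undirected edge occurs as two opposite arcs, so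
  undirected edges are counted as two-element vertex sets.
\<close>

definition uedge :: "'a \<times> 'a \<Rightarrow> 'a set" where
  "uedge e = {fst e, snd e}"

definition uedges :: "'a pair_pre_digraph \<Rightarrow> 'a set set" where
  "uedges G = uedge ` parcs G"

definition bicyclic :: "'a pair_pre_digraph \<Rightarrow> bool" where
  "bicyclic G \<longleftrightarrow> pair_graph G \<and> Digraph_Component.connected (with_proj G) \<and>
     card (uedges G) = card (pverts G) + 1"

text \<open>
  A cycle subgraph is represented by its set of undirected edges, which determines it. The
  bound on the length excludes the closed walks that run back and forth along a single edge,
  which \<^const>\<open>pre_digraph.cycle\<close> admits.
\<close>

definition cycle_edge_sets :: "'a pair_pre_digraph \<Rightarrow> 'a set set set" where
  "cycle_edge_sets G = {uedge ` set p | p. pre_digraph.cycle (with_proj G) p \<and> 3 \<le> length p}"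

text \<open>
  \<^const>\<open>disjoint\<close> says that any two distinct members of a family are disjoint, so this
  is the negation of ``the cycles are pairwise edge-disjoint''.
\<close>

definition theta_bicyclic :: "'a pair_pre_digraph \<Rightarrow> bool" where
  "theta_bicyclic G \<longleftrightarrow> bicyclic G \<and> \<not> disjoint (cycle_edge_sets G)"

text \<open>
  Since \<open>M\<close> is symmetric, its strongly connected components are its connected components.
\<close>

definition perfect_matching :: "'a pair_pre_digraph \<Rightarrow> 'a pair_pre_digraph \<Rightarrow> bool" where
  "perfect_matching M G \<longleftrightarrow> pair_graph M \<and> spanning (with_proj M) (with_proj G) \<and>
     (\<forall>C \<in> pre_digraph.sccs (with_proj M). complete_digraph 2 C)"

definition adjacency_mat :: "'a pair_pre_digraph \<Rightarrow> 'a list \<Rightarrow> int mat" where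
  "adjacency_mat G vs = mat (length vs) (length vs)
     (\<lambda>(i, j). if (vs ! i, vs ! j) \<in> parcs G then 1 else 0)"

text \<open>
  The adjacency matrix depends on an enumeration \<open>vs\<close> of the vertices. Its determinant does
  not, but rather than fixing an enumeration all of them are required to give \<open>-1\<close> or \<open>1\<close>.
\<close>

definition unimodular :: "'a pair_pre_digraph \<Rightarrow> bool" where
  "unimodular G \<longleftrightarrow> (\<forall>vs. distinct vs \<and> set vs = pverts G \<longrightarrow> det (adjacency_mat G vs) \<in> {-1, 1})"

end

theory Submission
  imports Defs "HOL-Combinatorics.Orbits"
begin

text \<open>
  In the Leibniz expansion of the determinant the nonzero terms belong to the permutations
  \<open>f\<close> of the vertices that send every vertex to a neighbour. The fixed-point-free involutions
  among them are exactly the perfect matchings, so it suffices that every such \<open>f\<close> is the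
  involution of the unique perfect matching: the expansion then has a single nonzero term,
  which is the sign of a permutation.

  Let \<open>L\<close> be the set of vertices with \<open>f (f v) \<noteq> v\<close>, that is, the union of the orbits of
  length at least 3. Each of these orbits traces a cycle of the graph, and different orbits
  trace vertex-disjoint cycles. The two facts that carry the proof are:

  \<^item> A \<open>\<theta>\<close>-type bicyclic graph has no two vertex-disjoint cycles
    (\<open>theta_no_disjoint_even_edge_sets\<close>). Its cycle space over the field with two elements has
    dimension \<open>|E| - |V| + 1 = 2\<close>, hence four elements. If \<open>C\<close> and \<open>D\<close> were vertex-disjoint
    cycles, these would be \<open>{}\<close>, \<open>C\<close>, \<open>D\<close> and \<open>C \<union> D\<close>, of which only \<open>C\<close> and \<open>D\<close> are
    cycles; the cycles of the graph would be edge-disjoint. Consequently \<open>L\<close> is empty or a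
    single orbit.

  \<^item> The cardinality of \<open>L\<close> is even, because \<open>V\<close> and \<open>V - L\<close> both carry fixed-point-free
    involutions: the given matching and \<open>f\<close>. So the cycle traced by \<open>L\<close> is even, and taking
    its edges alternately gives two perfect matchings, one for each of the two colour classes
    (\<open>alternation_gives_perfect_matching\<close>). By uniqueness they coincide, which is possible only
    if \<open>L\<close> is empty, that is, if \<open>f\<close> is an involution.
\<close>

section \<open>Parity of cardinalities\<close>

lemma odd_card_sym_diff:
  assumes "finite A" "finite B"
  shows "odd (card (sym_diff A B)) \<longleftrightarrow> odd (card A) \<noteq> odd (card B)"
proof -
  have "card (sym_diff A B) = card (A - B) + card (B - A)"
    using assms by (intro card_Un_disjoint) auto
  moreover have "card A = card (A - B) + card (A \<inter> B)"
    using assms by (metis Int_Diff_disjoint Int_commute Un_Diff_Int card_Un_disjoint finite_Diff finite_Int)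
  moreover have "card B = card (B - A) + card (A \<inter> B)"
    using assms by (metis Int_Diff_disjoint Int_commute Un_Diff_Int card_Un_disjoint finite_Diff finite_Int)
  ultimately show ?thesis by presburger
qed

lemma even_card_fixpoint_free_involution:
  assumes "finite A" "\<And>x. x \<in> A \<Longrightarrow> f x \<in> A" "\<And>x. x \<in> A \<Longrightarrow> f x \<noteq> x" "\<And>x. x \<in> A \<Longrightarrow> f (f x) = x"
  shows "even (card A)"
  using assms
proof (induction A rule: finite_psubset_induct)
  case (psubset A)
  show ?case
  proof (cases "A = {}")
    case False
    then obtain x where x: "x \<in> A" by blast
    let ?B = "A - {x, f x}"
    have xf: "{x, f x} \<subseteq> A" "card {x, f x} = 2"
      using x psubset.prems by (auto simp: card_2_iff)
    have inB: "f y \<in> ?B" if "y \<in> ?B" for y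
      using that x psubset.prems(1,3) by (metis Diff_iff insertCI insertE singletonD)
    have "even (card ?B)"
      by (rule psubset.IH) (use x inB psubset.prems in auto)
    moreover have "card A = card ?B + 2"
      using xf psubset.hyps by (metis card_Diff_subset card_mono finite_subset le_add_diff_inverse2)
    ultimately show ?thesis by simp
  qed simp
qed

section \<open>The cycle space modulo 2\<close>

text \<open>
  The boundary map from edge sets to vertex sets modulo 2. Its kernel, the edge sets \<open>F\<close> with
  \<open>odd_verts F = {}\<close>, is the cycle space. Sets under symmetric difference stand for vectors
  over the field with two elements.
\<close>

definition odd_verts :: "'a set set \<Rightarrow> 'a set" where
  "odd_verts F = {v. odd (card {e \<in> F. v \<in> e})}"

lemma odd_verts_empty [simp]: "odd_verts {} = {}"
  by (simp add: odd_verts_def)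

lemma odd_verts_sym_diff:
  assumes "finite F" "finite G"
  shows "odd_verts (sym_diff F G) = sym_diff (odd_verts F) (odd_verts G)"
proof -
  have "{e \<in> sym_diff F G. v \<in> e} = sym_diff {e \<in> F. v \<in> e} {e \<in> G. v \<in> e}" for v
    by auto
  then have "v \<in> odd_verts (sym_diff F G) \<longleftrightarrow> v \<in> sym_diff (odd_verts F) (odd_verts G)" for v
    using odd_card_sym_diff[of "{e \<in> F. v \<in> e}" "{e \<in> G. v \<in> e}"] assms
    by (auto simp: odd_verts_def)
  then show ?thesis by blast
qed

lemma odd_verts_edge:
  assumes "u \<noteq> v"
  shows "odd_verts {{u, v}} = sym_diff {u} {v}"
proof -
  have "{e \<in> {{u, v}}. w \<in> e} = (if w \<in> {u, v} then {{u, v}} else {})" for w by auto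
  then show ?thesis using assms by (auto simp: odd_verts_def split: if_splits)
qed

text \<open>
  The boundary of an edge set in a connected graph can be prescribed freely away from a root
  \<open>r\<close>: the symmetric difference of the paths from the chosen vertices to \<open>r\<close> has the desired
  boundary. Only the root is left undetermined, as the boundary always has even cardinality.
\<close>

lemma exists_prescribed_odd_verts:
  assumes E: "finite E" and S: "finite S" "S \<subseteq> V - {r}"
    and join: "\<And>v. v \<in> V \<Longrightarrow> \<exists>F \<subseteq> E. odd_verts F = sym_diff {v} {r}"
  shows "\<exists>F \<subseteq> E. odd_verts F - {r} = S"
  using S
proof (induction S rule: finite_induct)
  case empty
  show ?case by (rule exI[of _ "{}"]) simp
next
  case (insert x S)
  then obtain F P where F: "F \<subseteq> E" "odd_verts F - {r} = S"
    and P: "P \<subseteq> E" "odd_verts P = sym_diff {x} {r}"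
    using join[of x] by auto
  have "odd_verts (sym_diff F P) = sym_diff (odd_verts F) (odd_verts P)"
    using F P E by (intro odd_verts_sym_diff) (auto intro: finite_subset)
  then have "odd_verts (sym_diff F P) - {r} = insert x S"
    using F(2) P(2) insert.hyps insert.prems by auto
  then show ?case using F(1) P(1) by (intro exI[of _ "sym_diff F P"]) auto
qed

text \<open>
  This is the bound \<open>|E| - |V| + 1\<close> on the dimension of the cycle space, in multiplicative form.
  Adding to an element of the cycle space a chosen edge set for each prescribed boundary gives
  different edge sets, since the boundary recovers the chosen summand.
\<close>

lemma card_even_edge_sets_le:
  assumes E: "finite E" and V: "finite V" "r \<in> V"
    and join: "\<And>v. v \<in> V \<Longrightarrow> \<exists>F \<subseteq> E. odd_verts F = sym_diff {v} {r}"
  shows "card {F. F \<subseteq> E \<and> odd_verts F = {}} * 2 ^ (card V - 1) \<le> 2 ^ card E"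
proof -
  let ?K = "{F. F \<subseteq> E \<and> odd_verts F = {}}" and ?W = "Pow (V - {r})"
  have "\<forall>S \<in> ?W. \<exists>F \<subseteq> E. odd_verts F - {r} = S"
    using exists_prescribed_odd_verts[OF E _ _ join] V by (meson PowD finite_Diff finite_subset)
  then obtain g where g: "\<And>S. S \<in> ?W \<Longrightarrow> g S \<subseteq> E" "\<And>S. S \<in> ?W \<Longrightarrow> odd_verts (g S) - {r} = S"
    by metis
  let ?h = "\<lambda>(K, S). sym_diff K (g S)"
  have "inj_on ?h (?K \<times> ?W)"
  proof (rule inj_onI, clarify)
    fix K S K' S'
    assume K: "K \<subseteq> E" "odd_verts K = {}" and K': "K' \<subseteq> E" "odd_verts K' = {}"
      and S: "S \<subseteq> V - {r}" "S' \<subseteq> V - {r}" and eq: "sym_diff K (g S) = sym_diff K' (g S')"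
    have fin: "finite K" "finite K'" "finite (g S)" "finite (g S')"
      using K(1) K'(1) S g(1) E by (meson PowI finite_subset)+
    have "odd_verts (g S) = odd_verts (g S')"
      using odd_verts_sym_diff[OF fin(1,3)] odd_verts_sym_diff[OF fin(2,4)] eq K K' by simp
    then have "S = S'" using g(2) S by (metis PowI)
    with eq show "K = K' \<and> S = S'" by blast
  qed
  moreover have "?h ` (?K \<times> ?W) \<subseteq> Pow E"
  proof (rule image_subsetI, elim SigmaE)
    fix x K S assume "K \<in> ?K" "S \<in> ?W" "x = (K, S)"
    then show "?h x \<in> Pow E" using g(1)[of S] by auto
  qed
  ultimately have "card (?K \<times> ?W) \<le> card (Pow E)"
    using E by (intro card_inj_on_le) auto
  then show ?thesis using V E by (simp add: card_cartesian_product card_Pow)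
qed

text \<open>
  At a vertex \<open>v\<close> of an invariant set exactly the two steps into \<open>v\<close> and out of \<open>v\<close> meet. They
  are different edges because \<open>f\<close> does not swap \<open>v\<close> with its predecessor.
\<close>

lemma odd_verts_permutation_steps:
  assumes f: "inj f" and A: "finite A" "f ` A \<subseteq> A" and ff: "\<And>v. v \<in> A \<Longrightarrow> f (f v) \<noteq> v"
  shows "odd_verts ((\<lambda>v. {v, f v}) ` A) = {}"
proof -
  have fA: "f ` A = A" using A f by (simp add: endo_inj_surj inj_on_subset)
  have "even (card {e \<in> (\<lambda>v. {v, f v}) ` A. v \<in> e})" for v
  proof (cases "v \<in> A")
    case True
    then have "v \<in> f ` A" using fA by simp
    then obtain u where u: "u \<in> A" "v = f u" by (rule imageE)
    have "v \<in> {w, f w} \<longleftrightarrow> w = v \<or> w = u" for w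
      using f u(2) by (auto simp: inj_eq)
    then have "{e \<in> (\<lambda>v. {v, f v}) ` A. v \<in> e} = (\<lambda>w. {w, f w}) ` {v, u}"
      using True u(1) by blast
    then have "{e \<in> (\<lambda>v. {v, f v}) ` A. v \<in> e} = {{v, f v}, {u, v}}"
      using u(2) by simp
    moreover have "{v, f v} \<noteq> {u, v}"
      using ff[OF u(1)] u(2) by (metis doubleton_eq_iff)
    ultimately show ?thesis by simp
  next
    case False
    then have "{e \<in> (\<lambda>v. {v, f v}) ` A. v \<in> e} = {}" using A by auto
    then show ?thesis by (metis card.empty even_zero)
  qed
  then show ?thesis by (simp add: odd_verts_def)
qed

section \<open>Cycles of a graph\<close>

lemma uedge_Pair [simp]: "uedge (u, v) = {u, v}"
  by (simp add: uedge_def)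

lemma uedge_awalk_subset:
  assumes "pair_wf_digraph G" "pre_digraph.awalk (with_proj G) u p v" "e \<in> set p"
  shows "uedge e \<subseteq> set (pawalk_verts u p)"
proof -
  interpret pair_wf_digraph G by fact
  have "pcas u p v" using assms(2) by (simp add: awalk_def)
  then show ?thesis using assms(3)
  proof (induction p arbitrary: u)
    case (Cons a p)
    then show ?case by (cases p) (auto simp: uedge_def)
  qed simp
qed

text \<open>
  The boundaries of the single edges telescope. On a path no edge occurs twice, so that the set
  of its edges is indeed the symmetric difference of its edges.
\<close>

lemma odd_verts_apath:
  assumes G: "pair_graph G" and p: "pre_digraph.apath (with_proj G) u p v"
  shows "odd_verts (uedge ` set p) = sym_diff {u} {v}"
proof -
  interpret pair_graph G by fact
  from p show ?thesis
  proof (induction p arbitrary: u)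
    case Nil
    then show ?case by (simp add: apath_Nil_iff)
  next
    case (Cons e p)
    obtain w where e: "e = (u, w)" using Cons.prems by (cases e) (auto simp: apath_Cons_iff)
    have p: "apath w p v" "u \<notin> set (pawalk_verts w p)" "(u, w) \<in> parcs G"
      using Cons.prems e by (auto simp: apath_Cons_iff)
    have "uedge e \<notin> uedge ` set p"
      using uedge_awalk_subset[OF pair_wf_digraph, of w p v] p e by (auto simp: apath_def)
    then have "uedge ` set (e # p) = sym_diff {{u, w}} (uedge ` set p)" using e by auto
    moreover have "u \<noteq> w" using p(3) no_loops' by blast
    ultimately show ?case
      using odd_verts_sym_diff[of "{{u, w}}" "uedge ` set p"] Cons.IH[OF p(1)] odd_verts_edge[of u w]
      by auto
  qed
qed

text \<open>
  A cycle is an arc followed by a path back between its ends, and the two boundaries cancel.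
  The bound on the length is what keeps that path from returning along the same edge.
\<close>

lemma odd_verts_cycle:
  assumes G: "pair_graph G" and p: "pre_digraph.cycle (with_proj G) p" "3 \<le> length p"
  shows "odd_verts (uedge ` set p) = {}"
proof -
  interpret pair_graph G by fact
  obtain u where u: "awalk u p u" "distinct (tl (pawalk_verts u p))" "p \<noteq> []"
    using p(1) by (auto simp: cycle_def)
  then obtain v q where q: "p = (u, v) # q" "(u, v) \<in> parcs G" "awalk v q u"
    by (cases p) (auto simp: awalk_Cons_iff)
  with u have path: "apath v q u" by (auto simp: apath_def)
  have uv: "u \<noteq> v" using q(2) no_loops' by blast
  then obtain w q' where q': "q = (v, w) # q'" using path
    by (cases q) (auto simp: apath_simps)
  have path': "apath w q' u" "v \<notin> set (pawalk_verts w q')" using path q' by (auto simp: apath_simps)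
  have "w \<noteq> u"
  proof
    assume "w = u"
    then have "q' = []" using path'(1) apath_nonempty_ends by blast
    then show False using p(2) q(1) q' by simp
  qed
  moreover have "{u, v} \<notin> uedge ` set q'"
    using uedge_awalk_subset[OF pair_wf_digraph, of w q' u] path' by (auto simp: apath_def)
  ultimately have "{u, v} \<notin> uedge ` set q" using q' by (auto simp: doubleton_eq_iff)
  then have "uedge ` set p = sym_diff {{u, v}} (uedge ` set q)" using q(1) by auto
  then show ?thesis
    using odd_verts_sym_diff[of "{{u, v}}" "uedge ` set q"] odd_verts_apath[OF G path]
      odd_verts_edge[OF uv] by auto
qed

text \<open>
  Connectedness of a walk: it cannot change between two vertex-disjoint edge sets. This is why
  the union of two vertex-disjoint even edge sets is not a cycle.
\<close>

lemma walk_stays_in_part: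
  assumes "pcas u p v" "uedge ` set p \<subseteq> C \<union> D" "\<Union>C \<inter> \<Union>D = {}" "u \<notin> \<Union>D"
  shows "uedge ` set p \<subseteq> C"
  using assms
proof (induction p arbitrary: u)
  case (Cons e p)
  have e: "uedge e \<in> C" using Cons.prems by (auto simp: uedge_def)
  then have "snd e \<in> \<Union>C" by (auto simp: uedge_def)
  then have "uedge ` set p \<subseteq> C" using Cons by (intro Cons.IH[of "snd e"]) auto
  with e show ?case by simp
qed simp

lemma connected_joins:
  assumes G: "pair_graph G" and conn: "Digraph_Component.connected (with_proj G)"
    and uv: "u \<in> pverts G" "v \<in> pverts G"
  shows "\<exists>F \<subseteq> uedges G. odd_verts F = sym_diff {u} {v}"
proof -
  interpret pair_graph G by fact
  have "u \<rightarrow>\<^sup>*\<^bsub>mk_symmetric G\<^esub> v"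
    using conn uv by (auto simp: connected_def strongly_connected_def)
  then have "u \<rightarrow>\<^sup>*\<^bsub>with_proj G\<^esub> v" using reachable_mk_symmetric_eq[OF sym_arcs] by blast
  then obtain p where p: "apath u p v" using reachable_apath by blast
  then have "uedge ` set p \<subseteq> uedges G" by (auto simp: uedges_def apath_def awalk_def)
  then show ?thesis using odd_verts_apath[OF G p] by blast
qed

text \<open>
  Counting shows that \<open>{}\<close>, \<open>C\<close>, \<open>D\<close> and \<open>C \<union> D\<close> exhaust the cycle space. The set of edges of a
  cycle is one of them, and being connected it can only be \<open>C\<close> or \<open>D\<close>. As these are disjoint,
  any two different cycles are edge-disjoint, which contradicts the \<open>\<theta>\<close>-type.
\<close>

lemma theta_no_disjoint_even_edge_sets:
  assumes theta: "theta_bicyclic G"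
    and C: "C \<subseteq> uedges G" "odd_verts C = {}" "C \<noteq> {}"
    and D: "D \<subseteq> uedges G" "odd_verts D = {}" "D \<noteq> {}"
    and disj: "\<Union>C \<inter> \<Union>D = {}"
  shows False
proof -
  have G: "pair_graph G" and conn: "Digraph_Component.connected (with_proj G)"
    and cardE: "card (uedges G) = card (pverts G) + 1" and nd: "\<not> disjoint (cycle_edge_sets G)"
    using theta by (auto simp: theta_bicyclic_def bicyclic_def)
  interpret pair_graph G by fact
  have finE: "finite (uedges G)" by (simp add: uedges_def)
  have CD: "C \<inter> D = {}"
  proof -
    have "e \<noteq> {}" if "e \<in> C" for e using that C(1) by (auto simp: uedges_def uedge_def)
    then show ?thesis using disj by blast
  qed
  obtain r where r: "r \<in> pverts G"
    using C(1,3) arc_fst_in_verts unfolding uedges_def by blast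
  let ?K = "{F. F \<subseteq> uedges G \<and> odd_verts F = {}}"
  have "card ?K * 2 ^ (card (pverts G) - 1) \<le> 2 ^ card (uedges G)"
    using card_even_edge_sets_le[OF finE _ r connected_joins[OF G conn _ r]] by simp
  moreover have "card (pverts G) > 0" using r by (auto simp: card_gt_0_iff)
  then have "(2::nat) ^ card (uedges G) = 4 * 2 ^ (card (pverts G) - 1)"
    unfolding cardE by (cases "card (pverts G)") auto
  ultimately have K4: "card ?K \<le> 4" by simp
  have "sym_diff C D = C \<union> D" using CD by auto
  then have "odd_verts (C \<union> D) = {}"
    using odd_verts_sym_diff[of C D] C D finE by (metis Diff_empty finite_subset sup_bot.right_neutral)
  then have sub: "{{}, C, D, C \<union> D} \<subseteq> ?K" using C D by auto
  have "card {{}, C, D, C \<union> D} = 4" 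
  proof -
    have "C \<noteq> D" "C \<noteq> C \<union> D" "D \<noteq> C \<union> D" using C(3) D(3) CD by blast+
    then show ?thesis using C(3) D(3) by (simp add: card_insert_if)
  qed
  then have K: "?K = {{}, C, D, C \<union> D}"
    using sub K4 finE by (intro card_seteq[symmetric]) auto
  (* Every cycle of G has edge set C or D. *)
  have "uedge ` set p \<in> {C, D}" if p: "cycle p" "3 \<le> length p" for p
  proof -
    obtain u where u: "awalk u p u" using p(1) by (auto simp: cycle_def)
    then have "uedge ` set p \<subseteq> uedges G" by (auto simp: uedges_def awalk_def)
    then have "uedge ` set p \<in> ?K" using odd_verts_cycle[OF G p] by simp
    then have mem: "uedge ` set p \<in> {{}, C, D, C \<union> D}" unfolding K .
    then have sub: "uedge ` set p \<subseteq> C \<union> D" by (elim insertE emptyE) simp_all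
    have walk: "pcas u p u" using u by (simp add: awalk_def)
    have "uedge ` set p \<subseteq> C \<or> uedge ` set p \<subseteq> D"
    proof (cases "u \<in> \<Union>D")
      case False
      then show ?thesis using walk_stays_in_part[OF walk sub disj] by blast
    next
      case True
      then have "u \<notin> \<Union>C" using disj by blast
      then show ?thesis using walk_stays_in_part[OF walk, of D C] sub disj by blast
    qed
    moreover have "uedge ` set p \<noteq> {}" using p(2) by auto
    moreover have "Q \<in> {C, D}"
      if "Q \<in> {{}, C, D, C \<union> D}" "Q \<subseteq> C \<or> Q \<subseteq> D" "Q \<noteq> {}" for Q
      using that CD C(3) D(3) by blast
    ultimately show ?thesis using mem by metis
  qed
  then have "cycle_edge_sets G \<subseteq> {C, D}"
    unfolding cycle_edge_sets_def by (intro subsetI, elim CollectE exE conjE) simp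
  then have "disjoint (cycle_edge_sets G)"
    using CD by (auto simp: disjoint_def)
  with nd show False by blast
qed

lemma theta_no_disjoint_invariant_sets:
  assumes theta: "theta_bicyclic G" and f: "f permutes pverts G"
    and arcs: "\<And>v. v \<in> pverts G \<Longrightarrow> (v, f v) \<in> parcs G"
    and A: "A \<subseteq> {v \<in> pverts G. f (f v) \<noteq> v}" "f ` A \<subseteq> A" "A \<noteq> {}"
    and B: "B \<subseteq> {v \<in> pverts G. f (f v) \<noteq> v}" "f ` B \<subseteq> B" "B \<noteq> {}"
  shows "A \<inter> B \<noteq> {}"
proof
  assume disj: "A \<inter> B = {}"
  interpret pair_graph G using theta by (simp add: theta_bicyclic_def bicyclic_def)
  let ?s = "\<lambda>v. {v, f v}"
  have fin: "finite A" "finite B" using A B by (auto intro: finite_subset[OF _ pair_finite_verts])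
  have inj: "inj f" using f by (rule permutes_inj)
  have sub: "?s ` X \<subseteq> uedges G" if "X \<subseteq> {v \<in> pverts G. f (f v) \<noteq> v}" for X
    using that arcs by (force simp: uedges_def)
  have "\<Union> (?s ` A) \<inter> \<Union> (?s ` B) = {}" using A(2) B(2) disj by blast
  moreover have "odd_verts (?s ` A) = {}" "odd_verts (?s ` B) = {}"
    by (intro odd_verts_permutation_steps inj fin A(2) B(2); use A(1) B(1) in blast)+
  ultimately show False
    using A(3) B(3)
    by (intro theta_no_disjoint_even_edge_sets[OF theta sub[OF A(1)] _ _ sub[OF B(1)]]) simp_all
qed

section \<open>Alternation along an orbit\<close>

text \<open>
  Along an orbit of even length the elements at even distance from the start form a colour class
  \<open>X\<close> of a proper 2-colouring; evenness is needed where the orbit closes up.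
\<close>

lemma even_orbit_alternates:
  assumes v: "v \<in> orbit f v" and even: "even (card (orbit f v))"
  obtains X where "X \<subseteq> orbit f v" "\<And>w. w \<in> orbit f v \<Longrightarrow> f w \<in> X \<longleftrightarrow> w \<notin> X"
proof -
  let ?n = "funpow_dist1 f v v" and ?g = "\<lambda>k. (f ^^ k) v"
  have orb: "orbit f v = ?g ` {0..<?n}" using v by (rule orbit_conv_funpow_dist1)
  have inj: "inj_on ?g {0..<?n}" using v by (rule inj_on_funpow_dist1)
  have n: "even ?n" using even orb inj by (simp add: card_image del: funpow.simps)
  have per: "?g ?n = v" using v by (rule funpow_dist1_prop)
  let ?X = "?g ` {k \<in> {0..<?n}. even k}"
  have mem: "?g k \<in> ?X \<longleftrightarrow> even k" if "k < ?n" for k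
    using that inj by (fastforce simp: inj_on_def simp del: funpow.simps)
  show thesis
  proof (rule that[of ?X])
    show "?X \<subseteq> orbit f v" using orb by blast
    fix w assume "w \<in> orbit f v"
    then obtain k where k: "k < ?n" "w = ?g k" using orb by auto
    have fw: "f w = ?g (Suc k)" using k by simp
    show "f w \<in> ?X \<longleftrightarrow> w \<notin> ?X"
    proof (cases "Suc k < ?n")
      case True
      then show ?thesis using mem[OF True] mem[OF k(1)] fw k(2) by simp
    next
      case False
      then have Suc: "Suc k = ?n" using k by simp
      have "f w = ?g 0" using fw per unfolding Suc by simp
      then have "f w \<in> ?X" using mem[of 0] by simp
      moreover have "odd k" using n Suc by (metis even_Suc)
      then have "w \<notin> ?X" using mem[OF k(1)] k(2) by simp
      ultimately show ?thesis by simp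
    qed
  qed
qed

section \<open>Perfect matchings as involutions\<close>

definition matching_of :: "'a set \<Rightarrow> ('a \<Rightarrow> 'a) \<Rightarrow> 'a pair_pre_digraph" where
  "matching_of V f = \<lparr>pverts = V, parcs = {(v, f v) | v. v \<in> V}\<rparr>"

lemma matching_of_eq_iff: "matching_of V f = matching_of V g \<longleftrightarrow> (\<forall>v \<in> V. f v = g v)"
  by (auto simp: matching_of_def)

text \<open>
  Each component of the graph consists of a vertex \<open>u\<close> and its partner \<open>f u\<close>, because nothing
  else can be reached from \<open>u\<close>.
\<close>

lemma perfect_matching_of_involution:
  assumes G: "pair_graph G"
    and f: "\<And>v. v \<in> pverts G \<Longrightarrow> (v, f v) \<in> parcs G" "\<And>v. v \<in> pverts G \<Longrightarrow> f (f v) = v"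
  shows "perfect_matching (matching_of (pverts G) f) G"
proof -
  interpret G: pair_graph G by fact
  let ?M = "matching_of (pverts G) f"
  have fV: "f v \<in> pverts G" "f v \<noteq> v" if "v \<in> pverts G" for v
    using f(1)[OF that] G.in_arcsD2 G.no_loops' by metis+
  have V[simp]: "pverts ?M = pverts G" and A: "parcs ?M = {(v, f v) | v. v \<in> pverts G}"
    by (simp_all add: matching_of_def)
  interpret M: pair_graph ?M
  proof
    show "finite (parcs ?M)"
      using G.pair_finite_arcs f(1) by (rule_tac finite_subset[of _ "parcs G"]) (auto simp: A)
    show "symmetric ?M" using f(2) fV by (auto simp: symmetric_def sym_def A)
  qed (use fV G.pair_finite_verts in \<open>force simp: A\<close>)+
  have reach: "u \<rightarrow>\<^sup>*\<^bsub>with_proj ?M\<^esub> v \<longleftrightarrow> v = u \<or> v = f u" if u: "u \<in> pverts G" for u v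
  proof
    assume "u \<rightarrow>\<^sup>*\<^bsub>with_proj ?M\<^esub> v"
    then show "v = u \<or> v = f u"
    proof (induction rule: M.reachable_induct)
      case (step x y)
      then show ?case using f(2) u by (auto simp: A)
    qed simp
  next
    assume "v = u \<or> v = f u"
    then show "u \<rightarrow>\<^sup>*\<^bsub>with_proj ?M\<^esub> v"
    proof
      assume "v = u"
      then show ?thesis using u by (simp add: M.reachable_refl)
    next
      assume "v = f u"
      then show ?thesis using u by (intro M.reachable_adjI) (auto simp: A)
    qed
  qed
  have "complete_digraph 2 C" if C: "C \<in> M.sccs" for C
  proof -
    obtain S where S: "S \<in> M.sccs_verts" "C = with_proj ?M \<restriction> S"
      using C by (auto simp: M.sccs_conv_sccs_verts)
    then obtain u where u: "u \<in> pverts G" "S = M.scc_of u"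
      by (auto simp: M.sccs_verts_conv_scc_of)
    have S_eq: "S = {u, f u}"
    proof -
      have "u \<rightarrow>\<^sup>*\<^bsub>with_proj ?M\<^esub> v \<and> v \<rightarrow>\<^sup>*\<^bsub>with_proj ?M\<^esub> u \<longleftrightarrow> v = u \<or> v = f u" for v
        using reach[OF u(1)] reach[OF fV(1)[OF u(1)]] f(2)[OF u(1)] by metis
      then have "M.scc_of u = {v. v = u \<or> v = f u}" unfolding M.scc_of_def by (simp only:)
      also have "{v. v = u \<or> v = f u} = {u, f u}" by blast
      finally show ?thesis unfolding u(2) .
    qed
    have ind: "induced_subgraph C (with_proj ?M)" using C by (rule M.in_sccs_imp_induced)
    then have "digraph C" "sym_digraph C"
      by (rule M.digraphI_induced, rule M.induced_graph_imp_graph)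
    then have "graph C" by (intro graph.intro pseudo_graph.intro) (auto simp: digraph_def)
    moreover have "card (verts C) = 2" using S_eq fV(2)[OF u(1)] S(2) by (auto simp: card_2_iff)
    moreover have "arcs_ends C = {(a, b). (a, b) \<in> verts C \<times> verts C \<and> a \<noteq> b}"
      using S(2) S_eq u(1) fV[OF u(1)] fV(2)[OF u(1), symmetric] f(2)[OF u(1)]
      by (auto simp: arcs_ends_def arc_to_ends_def A)
    ultimately show ?thesis by (simp add: complete_digraph_def)
  qed
  moreover have "spanning (with_proj ?M) (with_proj G)"
    using f(1) G.wf_digraph_axioms M.wf_digraph_axioms by (auto simp: spanning_def subgraph_def A)
  ultimately show ?thesis by (auto simp: perfect_matching_def)
qed

text \<open>
  Conversely, the component of a vertex \<open>v\<close> in a perfect matching is a \<open>K\<^sub>2\<close>, and so \<open>v\<close> has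
  exactly one neighbour there, which is taken as \<open>f v\<close>.
\<close>

lemma perfect_matching_involution:
  assumes "perfect_matching M G"
  obtains f where "M = matching_of (pverts G) f"
    and "\<And>v. v \<in> pverts G \<Longrightarrow> f v \<in> pverts G" and "\<And>v. v \<in> pverts G \<Longrightarrow> f v \<noteq> v"
    and "\<And>v. v \<in> pverts G \<Longrightarrow> f (f v) = v" and "\<And>v. v \<in> pverts G \<Longrightarrow> (v, f v) \<in> parcs G"
proof -
  interpret M: pair_graph M using assms by (simp add: perfect_matching_def)
  have V: "pverts M = pverts G" and sub: "parcs M \<subseteq> parcs G"
    and K2: "\<And>C. C \<in> M.sccs \<Longrightarrow> complete_digraph 2 C"
    using assms by (auto simp: perfect_matching_def spanning_def subgraph_def)
  have ex1: "\<exists>!w. (v, w) \<in> parcs M" if v: "v \<in> pverts M" for v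
  proof -
    let ?S = "M.scc_of v"
    let ?C = "with_proj M \<restriction> ?S"
    have "?S \<in> M.sccs_verts" using M.scc_of_in_sccs_verts v by simp
    then have "?C \<in> M.sccs" using M.in_verts_sccsD_sccs by blast
    then have "complete_digraph 2 ?C" by (rule K2)
    then have card: "card ?S = 2" and ends: "arcs_ends ?C = {(a, b). (a, b) \<in> ?S \<times> ?S \<and> a \<noteq> b}"
      by (auto simp: complete_digraph_def)
    have vS: "v \<in> ?S" using M.in_scc_of_self v by simp
    obtain w where w: "?S = {v, w}" "v \<noteq> w" using card vS unfolding card_2_iff by (metis insertE insert_commute singletonD)
    have "(v, w) \<in> arcs_ends ?C" using ends w by auto
    then have "(v, w) \<in> parcs M" by (auto simp: arcs_ends_def arc_to_ends_def)
    moreover have "w' = w" if "(v, w') \<in> parcs M" for w'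
    proof -
      have "w' \<in> ?S" unfolding M.scc_of_def
        using that M.arcs_symmetric by (auto intro: M.reachable_adjI)
      then show ?thesis using w M.no_loops'[OF that] by auto
    qed
    ultimately show ?thesis by blast
  qed
  define f where "f v = (THE w. (v, w) \<in> parcs M)" for v
  have f: "(v, w) \<in> parcs M \<longleftrightarrow> w = f v" if "v \<in> pverts M" for v w
    using theI'[OF ex1[OF that]] ex1[OF that] unfolding f_def by blast
  show thesis
  proof (rule that[of f])
    have "(v, w) \<in> parcs M \<longleftrightarrow> v \<in> pverts M \<and> w = f v" for v w using f M.in_arcsD1 by metis
    then have "parcs M = {(v, f v) | v. v \<in> pverts M}" by auto
    then show "M = matching_of (pverts G) f" using V by (simp add: matching_of_def)
    fix v assume v: "v \<in> pverts G"
    then have vf: "(v, f v) \<in> parcs M" using f V by simp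
    then show "f v \<in> pverts G" "f v \<noteq> v" "(v, f v) \<in> parcs G"
      using M.in_arcsD2 M.no_loops' V sub by (metis, metis, blast)
    then show "f (f v) = v" using f M.arcs_symmetric[OF vf] V by metis
  qed
qed

section \<open>Permutations along edges\<close>

text \<open>
  Vertices of the colour class \<open>X\<close> are matched forwards, the other vertices on long orbits
  backwards; orbits of length 2 already are matching edges. The inverse of \<open>f\<close> is written as
  \<open>inv_into UNIV f\<close>, since \<open>inv\<close> is the notation for inverses in a group.
\<close>

lemma alternation_gives_perfect_matching:
  assumes G: "pair_graph G" and f: "f permutes pverts G"
    and arcs: "\<And>v. v \<in> pverts G \<Longrightarrow> (v, f v) \<in> parcs G"
    and X: "X \<subseteq> {v \<in> pverts G. f (f v) \<noteq> v}"
    and alt: "\<And>v. v \<in> pverts G \<Longrightarrow> f (f v) \<noteq> v \<Longrightarrow> f v \<in> X \<longleftrightarrow> v \<notin> X"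
  shows "perfect_matching (matching_of (pverts G)
    (\<lambda>v. if v \<in> X \<or> f (f v) = v then f v else inv_into UNIV f v)) G"
proof (rule perfect_matching_of_involution[OF G])
  interpret pair_graph G by fact
  let ?g = "\<lambda>v. if v \<in> X \<or> f (f v) = v then f v else inv_into UNIV f v"
  have inv: "f (inv_into UNIV f v) = v" "inv_into UNIV f (f v) = v" for v
    using f by (simp_all add: permutes_inverses)
  have fV: "f v \<in> pverts G \<longleftrightarrow> v \<in> pverts G" for v using f by (rule permutes_in_image)
  have injf: "f x = f y \<longleftrightarrow> x = y" for x y using inv by metis
  fix v assume v: "v \<in> pverts G"
  have iV: "inv_into UNIV f v \<in> pverts G" using fV inv v by metis
  show "(v, ?g v) \<in> parcs G" using arcs[OF v] arcs[OF iV] arcs_symmetric inv by auto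
  show "?g (?g v) = v"
  proof (cases "f (f v) = v")
    case True
    then show ?thesis by simp
  next
    case False
    show ?thesis
    proof (cases "v \<in> X")
      case True
      then have "f v \<notin> X" "f (f (f v)) \<noteq> f v" using alt[OF v False] False injf by auto
      then show ?thesis using True inv by simp
    next
      case vX: False
      have "f (f (inv_into UNIV f v)) \<noteq> inv_into UNIV f v" using False inv injf by metis
      then have "inv_into UNIV f v \<in> X" using alt[OF iV] vX inv by metis
      then show ?thesis using False vX inv by simp
    qed
  qed
qed

text \<open>
  The set \<open>?L\<close> of vertices on long orbits is a single orbit or empty, since a second orbit would
  give another vertex-disjoint even edge set. A proper 2-colouring of \<open>?L\<close> with colour classes
  \<open>X\<close> and \<open>?L - X\<close> yields two perfect matchings. They agree by uniqueness, so the successor of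
  every vertex in \<open>?L\<close> is also its predecessor, and there is no such vertex.
\<close>

lemma unique_matching_permutation:
  assumes theta: "theta_bicyclic G" and f: "f permutes pverts G"
    and arcs: "\<And>v. v \<in> pverts G \<Longrightarrow> (v, f v) \<in> parcs G"
    and M: "perfect_matching M G" "\<And>N. perfect_matching N G \<Longrightarrow> N = M"
  shows "M = matching_of (pverts G) f"
proof -
  have G: "pair_graph G" using theta by (simp add: theta_bicyclic_def bicyclic_def)
  interpret pair_graph G by fact
  let ?L = "{v \<in> pverts G. f (f v) \<noteq> v}"
  have fV: "f v \<in> pverts G \<longleftrightarrow> v \<in> pverts G" for v using f by (rule permutes_in_image)
  have injf: "f x = f y \<longleftrightarrow> x = y" for x y using permutes_inj[OF f] by (auto dest: injD)
  have fL: "f v \<in> ?L \<longleftrightarrow> v \<in> ?L" for v using fV injf by auto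
  have evenL: "even (card ?L)"
  proof -
    obtain m where "\<And>v. v \<in> pverts G \<Longrightarrow> m v \<in> pverts G" "\<And>v. v \<in> pverts G \<Longrightarrow> m v \<noteq> v"
      "\<And>v. v \<in> pverts G \<Longrightarrow> m (m v) = v"
      using perfect_matching_involution[OF M(1)] by metis
    then have "even (card (pverts G))" by (intro even_card_fixpoint_free_involution[of _ m]) auto
    moreover have "even (card (pverts G - ?L))"
    proof (rule even_card_fixpoint_free_involution[of _ f])
      fix v assume v: "v \<in> pverts G - ?L"
      show "f v \<in> pverts G - ?L" using v fL fV by blast
      show "f v \<noteq> v" using v arcs[of v] no_loops'[of v "f v"] by auto
      show "f (f v) = v" using v by blast
    qed simp
    moreover have "card (pverts G - ?L) = card (pverts G) - card ?L"
      by (intro card_Diff_subset) auto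
    moreover have "card ?L \<le> card (pverts G)" by (intro card_mono) auto
    ultimately show ?thesis by presburger
  qed
  have "\<exists>X \<subseteq> ?L. \<forall>v \<in> ?L. f v \<in> X \<longleftrightarrow> v \<notin> X"
  proof (cases "?L = {}")
    case True
    then show ?thesis by (intro exI[of _ "{}"]) auto
  next
    case False
    then obtain v where v: "v \<in> ?L" by blast
    have vO: "v \<in> orbit f v"
      using permutes_imp_permutation[OF pair_finite_verts f] by (rule permutation_self_in_orbit)
    have OL: "orbit f v \<subseteq> ?L"
    proof
      fix w assume "w \<in> orbit f v"
      then show "w \<in> ?L" by induction (use v fL in blast)+
    qed
    have Oinv: "f ` orbit f v \<subseteq> orbit f v" by (auto intro: orbit.step)
    have "f ` (?L - orbit f v) \<subseteq> ?L - orbit f v"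
    proof (rule image_subsetI)
      fix w assume w: "w \<in> ?L - orbit f v"
      have "f ` orbit f v = orbit f v"
        using Oinv OL permutes_inj[OF f]
        by (intro endo_inj_surj) (auto intro: finite_subset inj_on_subset)
      then have "f w \<in> orbit f v \<longrightarrow> w \<in> orbit f v" using injf by (metis imageE)
      then show "f w \<in> ?L - orbit f v" using w fL by blast
    qed
    then have "?L - orbit f v = {}"
      using theta_no_disjoint_invariant_sets[OF theta f arcs OL Oinv, of "?L - orbit f v"] vO by blast
    then have "orbit f v = ?L" using OL by blast
    then show ?thesis using even_orbit_alternates[OF vO] evenL by metis
  qed
  then obtain X where X: "X \<subseteq> ?L" and alt: "\<And>v. v \<in> ?L \<Longrightarrow> f v \<in> X \<longleftrightarrow> v \<notin> X" by blast
  let ?g = "\<lambda>X v. if v \<in> X \<or> f (f v) = v then f v else inv_into UNIV f v"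
  have P1: "perfect_matching (matching_of (pverts G) (?g X)) G"
    using X alt by (intro alternation_gives_perfect_matching[OF G f arcs]) auto
  have P2: "perfect_matching (matching_of (pverts G) (?g (?L - X))) G"
    using alt fL by (intro alternation_gives_perfect_matching[OF G f arcs]) auto
  have same: "?g X v = ?g (?L - X) v" if "v \<in> pverts G" for v
    using trans[OF M(2)[OF P1] M(2)[OF P2, symmetric]] that
    unfolding matching_of_eq_iff by (rule bspec)
  have "f (f v) = v" if v: "v \<in> pverts G" for v
  proof (rule ccontr)
    assume ff: "f (f v) \<noteq> v"
    then have "f v = inv_into UNIV f v" using same[OF v] v by (auto split: if_splits)
    then show False using ff f by (simp add: permutes_inverses)
  qed
  then show ?thesis unfolding M(2)[OF P1, symmetric] matching_of_eq_iff by simp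
qed

section \<open>The determinant\<close>

theorem lemma15:
  fixes B :: "'a pair_pre_digraph"
  assumes "theta_bicyclic B"
    and "\<exists>!M. perfect_matching M B"
  shows "unimodular B"
  unfolding unimodular_def
proof (intro allI impI, elim conjE)
  fix vs assume vs: "distinct vs" "set vs = pverts B"
  interpret pair_graph B using assms(1) by (simp add: theta_bicyclic_def bicyclic_def)
  obtain M where M: "perfect_matching M B" "\<And>N. perfect_matching N B \<Longrightarrow> N = M"
    using assms(2) by blast
  obtain m where Mm: "M = matching_of (pverts B) m"
    and m: "\<And>v. v \<in> pverts B \<Longrightarrow> m v \<in> pverts B" "\<And>v. v \<in> pverts B \<Longrightarrow> m (m v) = v"
      "\<And>v. v \<in> pverts B \<Longrightarrow> (v, m v) \<in> parcs B"
    using perfect_matching_involution[OF M(1)] by metis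
  let ?n = "length vs"
  let ?I = "{0..<?n}"
  let ?A = "adjacency_mat B vs"
  have bij: "bij_betw ((!) vs) ?I (pverts B)"
    using vs bij_betw_nth[of vs ?I "pverts B"] by (simp add: atLeast0LessThan)
  have entry: "?A $$ (i, j) = (if (vs ! i, vs ! j) \<in> parcs B then 1 else 0)" if "i < ?n" "j < ?n" for i j
    using that by (simp add: adjacency_mat_def)
  (* k is the involution of the matching, transported to the positions in vs *)
  define k where "k i = (if i \<in> ?I then inv_into ?I ((!) vs) (m (vs ! i)) else i)" for i
  have kI: "k i < ?n" "vs ! k i = m (vs ! i)" if i: "i < ?n" for i
  proof -
    have "vs ! i \<in> pverts B" using i vs(2) by (metis nth_mem)
    then have mi: "m (vs ! i) \<in> (!) vs ` ?I" using m(1) bij by (simp add: bij_betw_def)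
    then show "k i < ?n" using i inv_into_into[OF mi] by (simp add: k_def)
    show "vs ! k i = m (vs ! i)" using i f_inv_into_f[OF mi] by (simp add: k_def)
  qed
  have kperm: "k permutes ?I"
  proof (rule bij_imp_permutes)
    show "bij_betw k ?I ?I"
    proof (rule bij_betwI[of _ _ _ k])
      fix i assume "i \<in> ?I"
      then have i: "i < ?n" by simp
      have "vs ! k (k i) = vs ! i"
        using kI(2)[OF kI(1)[OF i]] kI(2)[OF i] m(2) i vs(2) by (metis nth_mem)
      then show "k (k i) = i" "k (k i) = i"
        using kI(1)[OF kI(1)[OF i]] i vs(1) by (simp_all add: nth_eq_iff_index_eq)
    qed (use kI in auto)
  qed (simp add: k_def)
  have only: "p = k" if p: "p permutes ?I" and nz: "(\<Prod>i = 0..<?n. ?A $$ (i, p i)) \<noteq> 0" for p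
  proof -
    (* the permutation p of positions, transported to the vertices *)
    define f where "f v = (if v \<in> pverts B then vs ! p (inv_into ?I ((!) vs) v) else v)" for v
    have f: "f permutes pverts B"
      unfolding f_def using permutes_bij_inv_into[OF p bij] .
    have pI: "p i < ?n" if "i < ?n" for i using permutes_in_image[OF p, of i] that by simp
    have fi: "f (vs ! i) = vs ! p i" if "i < ?n" for i
    proof -
      have "inv_into ?I ((!) vs) (vs ! i) = i"
        using bij that by (intro inv_into_f_f) (auto simp: bij_betw_def)
      then show ?thesis using that vs(2) by (auto simp: f_def)
    qed
    have "(v, f v) \<in> parcs B" if "v \<in> pverts B" for v
    proof -
      obtain i where i: "i < ?n" "v = vs ! i" using \<open>v \<in> pverts B\<close> vs(2) by (metis in_set_conv_nth)
      have "?A $$ (i, p i) \<noteq> 0" using nz i(1) by auto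
      then show ?thesis using entry[OF i(1) pI[OF i(1)]] fi[OF i(1)] i(2) by (simp split: if_splits)
    qed
    then have "M = matching_of (pverts B) f"
      using unique_matching_permutation[OF assms(1) f _ M] by blast
    then have fm: "f v = m v" if "v \<in> pverts B" for v
      using Mm that by (simp add: matching_of_eq_iff)
    show "p = k"
    proof
      fix i show "p i = k i"
      proof (cases "i < ?n")
        case True
        then have "vs ! p i = vs ! k i" using fi fm kI(2) vs(2) by (metis nth_mem)
        then show ?thesis using pI kI(1) True vs(1) by (simp add: nth_eq_iff_index_eq)
      next
        case False
        then show ?thesis using permutes_not_in[OF p] by (simp add: k_def)
      qed
    qed
  qed
  have prodk: "(\<Prod>i = 0..<?n. ?A $$ (i, k i)) = 1"
  proof (rule prod.neutral, rule ballI)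
    fix i assume "i \<in> ?I"
    then have i: "i < ?n" by simp
    have "(vs ! i, vs ! k i) \<in> parcs B" using kI(2)[OF i] m(3) i vs(2) by (metis nth_mem)
    then show "?A $$ (i, k i) = 1" using entry[OF i kI(1)[OF i]] by simp
  qed
  have "?A \<in> carrier_mat ?n ?n" by (simp add: adjacency_mat_def)
  then have "det ?A = (\<Sum>p | p permutes ?I. signof p * (\<Prod>i = 0..<?n. ?A $$ (i, p i)))"
    by (rule det_def')
  also have "\<dots> = (\<Sum>p \<in> {k}. signof p * (\<Prod>i = 0..<?n. ?A $$ (i, p i)))"
    using kperm only by (intro sum.mono_neutral_right) (auto simp: finite_permutations)
  also have "\<dots> = signof k" using prodk by simp
  finally show "det ?A \<in> {-1, 1}" by (auto simp: sign_def)
qed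

end
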